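(* Let $\mathbb{K}$ be an associative ring with unity (not necessarily commutative). Let $P$ be any finite poset. Let $f\in\mathbb{K}^{\widehat{P}}$ be a $\mathbb{K}$-labeling of $P$ such that $Rf\neq\bot$ and $f(0)=f(1)=1$, where $R$ is birational rowmotion of $P$. Assume that the inverses $\big((Rf)(v)\big)^{-1}$ appearing on the left-hand side below are well-defined. Then $$\sum_{\substack{u,v\in\widehat{P};\\ u\lessdot v}}(Rf)(u)\cdot\big((Rf)(v)\big)^{-1}=\sum_{\substack{u,v\in\widehat{P};\\ u\lessdot v}}f(u)\cdot\big(f(v)\big)^{-1}.$$
   Context: $\mathbb{K}$ is a fixed associative ring with unity, not necessarily commutative. An element is invertible if it has a two-sided inverse $x^{-1}$. An equality in which an inverse $x^{-1}$ appears is understood to include the assertion that $x$ is invertible (unless this is assumed). Extended poset. For a finite poset $P$, $\widehat{P}$ is the poset on the disjoint union $P\sqcup\{0,1\}$ in which $u\le v$ iff ($u,v\in P$ and $u\le v$ in $P$) or $u=0$ or $v=1$. Write $u\lessdot v$ (equivalently $v\gtrdot u$) if $u<v$ and no $w$ satisfies $u<w<v$ (in $\widehat{P}$). Labelings and partial maps. A $\mathbb{K}$-labeling of $P$ is a map $f:\widehat{P}\to\mathbb{K}$; the set of these is $\mathbb{K}^{\widehat{P}}$. A partial map $F:X\dashrightarrow Y$ is a map $X\to Y\sqcup\{\bot\}$, where $\bot$ means "undefined"; it is extended by $F(\bot)=\bot$, and partial maps are composed accordingly. Toggles. For $v\in P$, the toggle $T_v:\mathbb{K}^{\widehat{P}}\dashrightarrow\mathbb{K}^{\widehat{P}}$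 is defined by $(T_vf)(w)=f(w)$ for $w\ne v$ and $$(T_vf)(v)=\Big(\sum_{u\in\widehat{P},\,u\lessdot v}f(u)\Big)\cdot f(v)^{-1}\cdot\Big(\sum_{u\in\widehat{P},\,u\gtrdot v}f(u)^{-1}\Big)^{-1};$$ if any inverse in this formula does not exist, then $T_vf:=\bot$. Birational rowmotion. $R:=T_{v_1}\circ T_{v_2}\circ\cdots\circ T_{v_m}:\mathbb{K}^{\widehat{P}}\dashrightarrow\mathbb{K}^{\widehat{P}}$, where $(v_1,\ldots,v_m)$ is any linear extension of $P$ (a list of all elements of $P$, each exactly once, such that $v_i<v_j$ implies $i<j$); so the toggles at larger elements are applied first. This partial map does not depend on the choice of linear extension. *)

theory Defs
  imports Main
begin

text \<open>
  A finite poset is a carrier \<open>P\<close> with a relation \<open>r\<close> such that \<open>finite P\<close> and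
  \<open>partial_order_on P r\<close>; in particular the empty poset is allowed. The ring is a type of sort
  \<open>{ring, monoid_mult}\<close>: an associative ring with unity, not necessarily commutative. The class
  \<open>ring_1\<close> is not used because it excludes the zero ring.
\<close>

text \<open>
  The points of the poset \<open>P\<close> extended by a least element \<open>Bottom\<close> (written 0 in the literature) and a
  greatest element \<open>Top\<close> (written 1).
\<close>

datatype 'p hat = Bottom | Elt 'p | Top

definition hat_carrier :: "'p set \<Rightarrow> 'p hat set" where
  "hat_carrier P = {Bottom, Top} \<union> Elt ` P"

definition hat_rel :: "'p set \<Rightarrow> 'p rel \<Rightarrow> 'p hat rel" where
  "hat_rel P r = {(u, v). u \<in> hat_carrier P \<and> v \<in> hat_carrier P \<and>
     ((\<exists>x y. u = Elt x \<and> v = Elt y \<and> (x, y) \<in> r) \<or> u = Bottom \<or> v = Top)}"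

definition hat_less :: "'p set \<Rightarrow> 'p rel \<Rightarrow> 'p hat \<Rightarrow> 'p hat \<Rightarrow> bool" where
  "hat_less P r u v \<longleftrightarrow> (u, v) \<in> hat_rel P r \<and> u \<noteq> v"

definition hat_covers :: "'p set \<Rightarrow> 'p rel \<Rightarrow> ('p hat \<times> 'p hat) set" where
  "hat_covers P r = {(u, v). hat_less P r u v \<and> \<not> (\<exists>w. hat_less P r u w \<and> hat_less P r w v)}"

definition is_invertible :: "'a::{ring, monoid_mult} \<Rightarrow> bool" where
  "is_invertible x \<longleftrightarrow> (\<exists>y. x * y = 1 \<and> y * x = 1)"

text \<open>
  Meaningful only under \<open>is_invertible x\<close>, when the inverse is unique; the value is unspecified
  otherwise.
\<close>

definition ring_inv :: "'a::{ring, monoid_mult} \<Rightarrow> 'a" where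
  "ring_inv x = (THE y. x * y = 1 \<and> y * x = 1)"

text \<open>
  A labeling is a total function on \<open>'p hat\<close>, of which only the values on \<open>hat_carrier P\<close>
  matter: toggles at elements of \<open>P\<close> neither read nor change the others. Partial maps are maps
  into an option type, with \<open>None\<close> as the undefined value, and \<open>\<circ>\<^sub>m\<close> is
  composition of partial maps.
\<close>

type_synonym ('p, 'a) labeling = "'p hat \<Rightarrow> 'a"

definition toggle ::
  "'p set \<Rightarrow> 'p rel \<Rightarrow> 'p \<Rightarrow> ('p, 'a::{ring, monoid_mult}) labeling \<rightharpoonup> ('p, 'a) labeling" where
  "toggle P r v f =
     (let D = {u. (u, Elt v) \<in> hat_covers P r};
          U = {u. (Elt v, u) \<in> hat_covers P r};
          a = (\<Sum>u\<in>D. f u);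
          b = (\<Sum>u\<in>U. ring_inv (f u))
      in if is_invertible (f (Elt v)) \<and> (\<forall>u\<in>U. is_invertible (f u)) \<and> is_invertible b
         then Some (f(Elt v := a * ring_inv (f (Elt v)) * ring_inv b))
         else None)"

definition linear_extension :: "'p set \<Rightarrow> 'p rel \<Rightarrow> 'p list \<Rightarrow> bool" where
  "linear_extension P r vs \<longleftrightarrow> set vs = P \<and> distinct vs \<and>
     (\<forall>i<length vs. \<forall>j<length vs. (vs ! i, vs ! j) \<in> r \<and> vs ! i \<noteq> vs ! j \<longrightarrow> i < j)"

text \<open>
  For \<open>vs = [v\<^sub>1, \<dots>, v\<^sub>m]\<close> this is
  \<open>T\<^sub>v\<^sub>1 \<circ> \<dots> \<circ> T\<^sub>v\<^sub>m\<close>, so the toggle at the last entry is applied first.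
  It is birational rowmotion when \<open>vs\<close> is a linear extension of \<open>P\<close>; independence of the choice of
  \<open>vs\<close> is not built in, so statements about rowmotion quantify over all linear extensions.
\<close>

definition rowmotion ::
  "'p set \<Rightarrow> 'p rel \<Rightarrow> 'p list \<Rightarrow> ('p, 'a::{ring, monoid_mult}) labeling \<rightharpoonup> ('p, 'a) labeling" where
  "rowmotion P r vs = foldr (\<lambda>v F. toggle P r v \<circ>\<^sub>m F) vs Some"

end

theory Submission
  imports Defs
begin

text \<open>
  Write \<open>g = R f\<close>. For \<open>x \<in> P\<close> the definition of rowmotion says
  \<open>g(x) \<cdot> (\<Sum>\<^bsub>v covers x\<^esub> g(v)\<inverse>) = (\<Sum>\<^bsub>x covers u\<^esub> f(u)) \<cdot> f(x)\<inverse>\<close>.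
  Summing this over \<open>x\<close> matches all terms of the two sides of the claim except those with
  \<open>u = 0\<close> on the left and those with \<open>v = 1\<close> on the right. For these, put the weight
  \<open>g(v)\<inverse> \<cdot> f(u)\<close> on each edge of the Hasse diagram with lower end \<open>u\<close> and upper end \<open>v\<close>. By the
  same relation this weight is a flow, conserved at every \<open>x \<in> P\<close>, so the flow leaving \<open>0\<close> equals
  the flow entering \<open>1\<close>.
\<close>

text \<open>If \<open>y\<close> is a two-sided inverse of \<open>x\<close>, any \<open>z\<close>
  with \<open>x * z = 1\<close> satisfies \<open>z = y * x * z = y\<close>, so the definite
  description in \<open>ring_inv\<close> picks out \<open>y\<close>.\<close>

lemma right_ring_inv: "x * ring_inv x = 1"
  and left_ring_inv: "ring_inv x * x = 1"
  if "is_invertible x" for x :: "'a::{ring, monoid_mult}"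
proof -
  obtain y where y: "x * y = 1" "y * x = 1"
    using \<open>is_invertible x\<close> unfolding is_invertible_def by blast
  have "z = y" if "x * z = 1" for z
    by (metis that y(2) mult.assoc mult_1_left mult_1_right)
  then have "ring_inv x = y"
    unfolding ring_inv_def using y by blast
  then show "x * ring_inv x = 1" "ring_inv x * x = 1"
    using y by simp_all
qed

lemma is_invertible_one: "is_invertible (1 :: 'a::{ring, monoid_mult})"
  unfolding is_invertible_def by (metis mult_1_left)

lemma ring_inv_one: "ring_inv 1 = (1 :: 'a::{ring, monoid_mult})"
  using right_ring_inv[OF is_invertible_one] by simp

lemma hat_covers_Elt_EltD:
  "(Elt x, Elt y) \<in> hat_covers P r \<Longrightarrow> (x, y) \<in> r \<and> x \<noteq> y"
  by (auto simp: hat_covers_def hat_less_def hat_rel_def)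

lemma hat_covers_into_Bottom: "(u, Bottom) \<notin> hat_covers P r"
  by (auto simp: hat_covers_def hat_less_def hat_rel_def)

lemma hat_covers_from_Top: "(Top, v) \<notin> hat_covers P r"
  by (auto simp: hat_covers_def hat_less_def hat_rel_def)

lemma hat_covers_subset: "hat_covers P r \<subseteq> hat_carrier P \<times> hat_carrier P"
  by (auto simp: hat_covers_def hat_less_def hat_rel_def)

lemma finite_hat_carrier: "finite P \<Longrightarrow> finite (hat_carrier P)"
  by (simp add: hat_carrier_def)

text \<open>Transitivity of \<open>r\<close> alone might lead back to \<open>u = w\<close>;
  antisymmetry keeps the order strict.\<close>

lemma hat_less_trans:
  assumes "partial_order_on P r" and "hat_less P r u v" and "hat_less P r v w"
  shows "hat_less P r u w"
proof -
  have "trans r" "antisym r"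
    using assms(1) by (auto simp: partial_order_on_def preorder_on_def)
  then show ?thesis
    using assms(2,3) unfolding hat_less_def hat_rel_def
    by (cases u; cases v; cases w) (auto dest: transD antisymD)
qed

text \<open>A maximal element strictly below \<open>x\<close> is covered by \<open>x\<close>, and
  \<open>Bottom\<close> ensures that there is a candidate. Hence a condition imposed on the upper
  ends of all edges reaches every label on \<open>P\<close>.\<close>

lemma hat_covers_lower_exists:
  assumes "finite P" and "partial_order_on P r" and "x \<in> P"
  shows "\<exists>u. (u, Elt x) \<in> hat_covers P r"
proof -
  let ?A = "{w. hat_less P r w (Elt x)}"
  have "?A \<subseteq> hat_carrier P"
    by (auto simp: hat_less_def hat_rel_def)
  then have fin: "finite ?A"
    using assms(1) finite_hat_carrier finite_subset by blast
  have "Bottom \<in> ?A"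
    using assms(3) by (auto simp: hat_less_def hat_rel_def hat_carrier_def)
  then have ne: "?A \<noteq> {}"
    by blast
  have tr: "transp_on ?A (hat_less P r)"
    using hat_less_trans[OF assms(2)] by (blast intro: transp_onI)
  have as: "asymp_on ?A (hat_less P r)"
    using hat_less_trans[OF assms(2)] by (intro asymp_onI) (metis hat_less_def)
  obtain m where "m \<in> ?A" "\<forall>w\<in>?A. w \<noteq> m \<longrightarrow> \<not> hat_less P r m w"
    using Finite_Set.bex_max_element[OF fin as tr ne] by blast
  then have "(m, Elt x) \<in> hat_covers P r"
    by (auto simp: hat_covers_def) (metis hat_less_def)
  then show ?thesis ..
qed

text \<open>Edges are grouped by their lower end. No edge starts at \<open>Top\<close>, so
  \<open>Bottom\<close> is the only boundary term.\<close>

lemma sum_hat_covers_by_lower: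
  fixes h :: "'p hat \<Rightarrow> 'p hat \<Rightarrow> 'a::comm_monoid_add"
  assumes "finite P"
  shows "(\<Sum>(u, v)\<in>hat_covers P r. h u v) =
    (\<Sum>v | (Bottom, v) \<in> hat_covers P r. h Bottom v) +
    (\<Sum>x\<in>P. \<Sum>v | (Elt x, v) \<in> hat_covers P r. h (Elt x) v)"
proof -
  let ?U = "\<lambda>u. {v. (u, v) \<in> hat_covers P r}"
  have fin: "finite (?U u)" for u
    using finite_hat_carrier[OF assms] hat_covers_subset[of P r]
    by (auto intro: finite_subset[of _ "hat_carrier P"])
  have "hat_covers P r = Sigma (hat_carrier P) ?U"
    using hat_covers_subset[of P r] by auto
  then have "(\<Sum>(u, v)\<in>hat_covers P r. h u v) = (\<Sum>u\<in>hat_carrier P. \<Sum>v\<in>?U u. h u v)"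
    using fin finite_hat_carrier[OF assms] by (simp add: sum.Sigma)
  also have "\<dots> = (\<Sum>v\<in>?U Bottom. h Bottom v) + (\<Sum>u\<in>Elt ` P. \<Sum>v\<in>?U u. h u v)"
  proof -
    have "hat_carrier P = insert Bottom (insert Top (Elt ` P))"
      by (auto simp: hat_carrier_def)
    moreover have "Bottom \<notin> insert Top (Elt ` P)" "Top \<notin> Elt ` P"
      by auto
    ultimately show ?thesis
      using assms by (simp add: hat_covers_from_Top)
  qed
  also have "(\<Sum>u\<in>Elt ` P. \<Sum>v\<in>?U u. h u v) = (\<Sum>x\<in>P. \<Sum>v\<in>?U (Elt x). h (Elt x) v)"
    by (subst sum.reindex) (auto simp: inj_on_def)
  finally show ?thesis .
qed

lemma sum_hat_covers_by_upper:
  fixes h :: "'p hat \<Rightarrow> 'p hat \<Rightarrow> 'a::comm_monoid_add"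
  assumes "finite P"
  shows "(\<Sum>(u, v)\<in>hat_covers P r. h u v) =
    (\<Sum>u | (u, Top) \<in> hat_covers P r. h u Top) +
    (\<Sum>x\<in>P. \<Sum>u | (u, Elt x) \<in> hat_covers P r. h u (Elt x))"
proof -
  let ?D = "\<lambda>v. {u. (u, v) \<in> hat_covers P r}"
  have fin: "finite (?D v)" for v
    using finite_hat_carrier[OF assms] hat_covers_subset[of P r]
    by (auto intro: finite_subset[of _ "hat_carrier P"])
  \<comment> \<open>Swapping the pairs puts the upper end first, where \<open>sum.Sigma\<close> can
    group by it.\<close>
  have "(\<Sum>(u, v)\<in>hat_covers P r. h u v) =
      (\<Sum>(v, u)\<in>Sigma (hat_carrier P) ?D. h u v)"
    using hat_covers_subset[of P r]
    by (intro sum.reindex_bij_witness[of _ prod.swap prod.swap]) auto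
  also have "\<dots> = (\<Sum>v\<in>hat_carrier P. \<Sum>u\<in>?D v. h u v)"
    using fin finite_hat_carrier[OF assms] by (simp add: sum.Sigma)
  also have "\<dots> = (\<Sum>u\<in>?D Top. h u Top) + (\<Sum>v\<in>Elt ` P. \<Sum>u\<in>?D v. h u v)"
  proof -
    have "hat_carrier P = insert Top (insert Bottom (Elt ` P))"
      by (auto simp: hat_carrier_def)
    moreover have "Top \<notin> insert Bottom (Elt ` P)" "Bottom \<notin> Elt ` P"
      by auto
    ultimately show ?thesis
      using assms by (simp add: hat_covers_into_Bottom)
  qed
  also have "(\<Sum>v\<in>Elt ` P. \<Sum>u\<in>?D v. h u v) = (\<Sum>x\<in>P. \<Sum>u\<in>?D (Elt x). h u (Elt x))"
    by (subst sum.reindex) (auto simp: inj_on_def)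
  finally show ?thesis .
qed

lemma toggle_eq_SomeD:
  assumes "toggle P r x f = Some g"
  shows "is_invertible (f (Elt x))"
    and "is_invertible (\<Sum>u | (Elt x, u) \<in> hat_covers P r. ring_inv (f u))"
    and "g = f(Elt x := (\<Sum>u | (u, Elt x) \<in> hat_covers P r. f u) * ring_inv (f (Elt x)) *
      ring_inv (\<Sum>u | (Elt x, u) \<in> hat_covers P r. ring_inv (f u)))"
  using assms by (auto simp: toggle_def Let_def split: if_splits)

text \<open>
  When \<open>x\<close> is toggled, the labels above \<open>x\<close> have reached their final values and the labels at and
  below \<open>x\<close> are still the original ones. The statement is about suffixes of a linear extension
  so that it can be proved by induction.
\<close>

lemma rowmotion_values:
  fixes f g :: "('p, 'a::{ring, monoid_mult}) labeling"
  assumes "rowmotion P r ws f = Some g"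
    and "sorted_wrt (\<lambda>x y. (y, x) \<notin> r) ws" and "distinct ws"
  shows "(\<forall>w. w \<notin> Elt ` set ws \<longrightarrow> g w = f w) \<and>
    (\<forall>x\<in>set ws. is_invertible (f (Elt x)) \<and>
      is_invertible (\<Sum>u | (Elt x, u) \<in> hat_covers P r. ring_inv (g u)) \<and>
      g (Elt x) = (\<Sum>u | (u, Elt x) \<in> hat_covers P r. f u) * ring_inv (f (Elt x)) *
        ring_inv (\<Sum>u | (Elt x, u) \<in> hat_covers P r. ring_inv (g u)))"
  using assms
proof (induction ws arbitrary: g)
  case Nil
  then show ?case by (simp add: rowmotion_def)
next
  case (Cons y ws)
  obtain g' where g': "rowmotion P r ws f = Some g'" and tog: "toggle P r y g' = Some g"
    using Cons.prems(1) by (auto simp: rowmotion_def map_comp_Some_iff)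
  have same: "\<forall>w. w \<notin> Elt ` set ws \<longrightarrow> g' w = f w"
    and vals: "\<forall>x\<in>set ws. is_invertible (f (Elt x)) \<and>
      is_invertible (\<Sum>u | (Elt x, u) \<in> hat_covers P r. ring_inv (g' u)) \<and>
      g' (Elt x) = (\<Sum>u | (u, Elt x) \<in> hat_covers P r. f u) * ring_inv (f (Elt x)) *
        ring_inv (\<Sum>u | (Elt x, u) \<in> hat_covers P r. ring_inv (g' u))"
    using Cons.IH[OF g'] Cons.prems(2,3) by simp_all
  note toggled = toggle_eq_SomeD[OF tog]
  have off_y: "g w = g' w" if "w \<noteq> Elt y" for w
    using that toggled(3) by simp
  have upper: "(\<Sum>u | (Elt x, u) \<in> hat_covers P r. ring_inv (g u)) =
      (\<Sum>u | (Elt x, u) \<in> hat_covers P r. ring_inv (g' u))" if "x \<in> set (y # ws)" for x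
  proof (rule sum.cong[OF refl])
    fix u
    assume "u \<in> {u. (Elt x, u) \<in> hat_covers P r}"
    \<comment> \<open>If \<open>y\<close> covered \<open>x\<close>, then \<open>x\<close> would be
      an entry of \<open>ws\<close> below \<open>y\<close>, which the sorting excludes. So toggling
      \<open>y\<close> leaves these upper sums alone.\<close>
    then have "u \<noteq> Elt y"
      using that Cons.prems(2) by (auto dest!: hat_covers_Elt_EltD)
    then show "ring_inv (g u) = ring_inv (g' u)"
      by (simp add: off_y)
  qed
  have lower: "(\<Sum>u | (u, Elt y) \<in> hat_covers P r. g' u) =
      (\<Sum>u | (u, Elt y) \<in> hat_covers P r. f u)"
  proof (rule sum.cong[OF refl])
    fix u
    assume "u \<in> {u. (u, Elt y) \<in> hat_covers P r}"
    \<comment> \<open>By the sorting, no entry of \<open>ws\<close> lies below \<open>y\<close>, so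
      the labels read below \<open>y\<close> are untouched so far.\<close>
    then have "u \<notin> Elt ` set ws"
      using Cons.prems(2) by (auto dest!: hat_covers_Elt_EltD)
    then show "g' u = f u"
      using same by simp
  qed
  have y: "g' (Elt y) = f (Elt y)"
    using same Cons.prems(3) by auto
  have "g w = f w" if "w \<notin> Elt ` set (y # ws)" for w
    using that same off_y by auto
  moreover have "is_invertible (f (Elt x)) \<and>
      is_invertible (\<Sum>u | (Elt x, u) \<in> hat_covers P r. ring_inv (g u)) \<and>
      g (Elt x) = (\<Sum>u | (u, Elt x) \<in> hat_covers P r. f u) * ring_inv (f (Elt x)) *
        ring_inv (\<Sum>u | (Elt x, u) \<in> hat_covers P r. ring_inv (g u))"
    if "x \<in> set (y # ws)" for x
  proof (cases "x = y")
    case True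
    have "g (Elt y) = (\<Sum>u | (u, Elt y) \<in> hat_covers P r. f u) * ring_inv (f (Elt y)) *
        ring_inv (\<Sum>u | (Elt y, u) \<in> hat_covers P r. ring_inv (g' u))"
      using toggled(3) by (simp add: lower y)
    then show ?thesis
      using toggled(1,2) upper[OF that] True by (simp add: y)
  next
    case False
    then show ?thesis
      using vals that off_y upper[OF that] by simp
  qed
  ultimately show ?case by blast
qed

theorem proposition14p2:
  fixes P :: "'p set" and r :: "'p rel"
    and vs :: "'p list"
    and f Rf :: "('p, 'a::{ring, monoid_mult}) labeling"
  assumes "finite P" and "partial_order_on P r"
    and "linear_extension P r vs"
    and "rowmotion P r vs f = Some Rf"
    and "f Bottom = 1" and "f Top = 1"
    and "\<forall>(u, v)\<in>hat_covers P r. is_invertible (Rf v)"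
  shows "(\<forall>(u, v)\<in>hat_covers P r. is_invertible (f v)) \<and>
    (\<Sum>(u, v)\<in>hat_covers P r. Rf u * ring_inv (Rf v)) =
    (\<Sum>(u, v)\<in>hat_covers P r. f u * ring_inv (f v))"
proof -
  let ?C = "hat_covers P r"
  define D where "D x = (\<Sum>u | (u, Elt x) \<in> ?C. f u)" for x
  define U where "U x = (\<Sum>v | (Elt x, v) \<in> ?C. ring_inv (Rf v))" for x
  have vs: "set vs = P" "distinct vs"
    using assms(3) by (auto simp: linear_extension_def)
  \<comment> \<open>Unlike the indexed form in \<open>linear_extension\<close>, this form passes
    directly to suffixes. Entries at different positions differ because the list is
    distinct.\<close>
  have sorted: "sorted_wrt (\<lambda>x y. (y, x) \<notin> r) vs"
    using assms(3) unfolding linear_extension_def sorted_wrt_iff_nth_less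
    by (metis less_trans nat_neq_iff nth_eq_iff_index_eq)
  note val = rowmotion_values[OF assms(4) sorted vs(2)]
  have Bot: "Rf Bottom = 1" and Top: "Rf Top = 1"
    using val assms(5,6) by auto
  have inv_f: "is_invertible (f (Elt x))" if "x \<in> P" for x
    using val that vs(1) by blast
  have inv_Rf: "is_invertible (Rf (Elt x))" if "x \<in> P" for x
    using hat_covers_lower_exists[OF assms(1,2) that] assms(7) by blast
  \<comment> \<open>The toggle formula at \<open>x\<close>, with its last factor cleared by
    multiplying by \<open>U x\<close> on the right.\<close>
  have balance: "Rf (Elt x) * U x = D x * ring_inv (f (Elt x))" if "x \<in> P" for x
  proof -
    have "is_invertible (U x)"
      and "Rf (Elt x) = D x * ring_inv (f (Elt x)) * ring_inv (U x)"
      using val that vs(1) by (auto simp: U_def D_def)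
    then show ?thesis
      by (simp add: mult.assoc left_ring_inv)
  qed
  \<comment> \<open>The left side is the flow entering \<open>x\<close>, the right side the flow
    leaving it. Multiplying \<open>balance\<close> by \<open>f (Elt x)\<close> on the right and by
    the inverse of \<open>Rf (Elt x)\<close> on the left gives the equality.\<close>
  have conserved: "ring_inv (Rf (Elt x)) * D x = U x * f (Elt x)" if "x \<in> P" for x
  proof -
    have "D x = D x * ring_inv (f (Elt x)) * f (Elt x)"
      by (simp add: mult.assoc left_ring_inv[OF inv_f[OF that]])
    also have "\<dots> = Rf (Elt x) * (U x * f (Elt x))"
      by (simp add: balance[OF that, symmetric] mult.assoc)
    finally have "ring_inv (Rf (Elt x)) * D x =
        (ring_inv (Rf (Elt x)) * Rf (Elt x)) * (U x * f (Elt x))"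
      by (simp add: mult.assoc)
    then show ?thesis
      by (simp add: left_ring_inv[OF inv_Rf[OF that]])
  qed
  \<comment> \<open>The total weight of all edges is computed by lower and by upper ends; the two
    sums over \<open>P\<close> agree by \<open>conserved\<close> and cancel.\<close>
  have flow: "(\<Sum>v | (Bottom, v) \<in> ?C. ring_inv (Rf v)) = (\<Sum>u | (u, Top) \<in> ?C. f u)"
  proof -
    have "(\<Sum>v | (Bottom, v) \<in> ?C. ring_inv (Rf v)) + (\<Sum>x\<in>P. U x * f (Elt x)) =
        (\<Sum>(u, v)\<in>?C. ring_inv (Rf v) * f u)"
      by (simp add: sum_hat_covers_by_lower[OF assms(1)] assms(5) U_def sum_distrib_right)
    also have "\<dots> = (\<Sum>u | (u, Top) \<in> ?C. f u) + (\<Sum>x\<in>P. ring_inv (Rf (Elt x)) * D x)"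
      by (simp add: sum_hat_covers_by_upper[OF assms(1)] Top ring_inv_one D_def sum_distrib_left)
    finally show ?thesis
      by (simp add: conserved)
  qed
  \<comment> \<open>Grouping by lower ends here and by upper ends for \<open>f\<close> makes the
    terms at each \<open>x\<close> the two sides of \<open>balance\<close>.\<close>
  have "(\<Sum>(u, v)\<in>?C. Rf u * ring_inv (Rf v)) =
      (\<Sum>v | (Bottom, v) \<in> ?C. ring_inv (Rf v)) + (\<Sum>x\<in>P. Rf (Elt x) * U x)"
    by (simp add: sum_hat_covers_by_lower[OF assms(1)] Bot U_def sum_distrib_left)
  also have "\<dots> = (\<Sum>u | (u, Top) \<in> ?C. f u) + (\<Sum>x\<in>P. D x * ring_inv (f (Elt x)))"
    by (simp add: flow balance)
  also have "\<dots> = (\<Sum>(u, v)\<in>?C. f u * ring_inv (f v))"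
    by (simp add: sum_hat_covers_by_upper[OF assms(1)] assms(6) ring_inv_one D_def
        sum_distrib_right)
  finally have sums: "(\<Sum>(u, v)\<in>?C. Rf u * ring_inv (Rf v)) =
      (\<Sum>(u, v)\<in>?C. f u * ring_inv (f v))" .
  have "is_invertible (f v)" if "(u, v) \<in> ?C" for u v
    using that inv_f assms(6) hat_covers_subset[of P r]
    by (cases v) (auto simp: hat_covers_into_Bottom hat_carrier_def is_invertible_one)
  with sums show ?thesis
    by blast
qed

end
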